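(* Let $I\subseteq\mathbb{R}$ be an open invex subset with respect to $\eta:I\times I\to\mathbb{R}_+$, let $f:I\to\mathbb{R}$ be an absolutely continuous mapping on $I$, and let $a,b\in I$ with $\eta(b,a)\neq 0$. Let $q>1$ be fixed and $p=\frac{q}{q-1}$. If $|f'|^q$ is preinvex on $I$ with respect to $\eta$, then $$\left|\frac{1}{6}\left[f(a)+4f\left(\frac{2a+\eta(b,a)}{2}\right)+f(a+\eta(b,a))\right]-\frac{1}{\eta(b,a)}\int_a^{a+\eta(b,a)}f(x)\,dx\right|$$ $$\le\eta(b,a)\left(\frac{2(1+2^{p+1})}{6^{p+1}(p+1)}\right)^{\frac1p}\left[\frac{|f'(a)|^q+|f'(b)|^q}{2}\right]^{\frac1q}.$$
   Context: $\mathbb{R}_+=[0,\infty)$. A set $I\subseteq\mathbb{R}$ is invex with respect to $\eta:I\times I\to\mathbb{R}_+$ if $u+t\,\eta(v,u)\in I$ for all $u,v\in I$ and all $t\in[0,1]$. A function $g:I\to\mathbb{R}$ on an invex set $I$ is preinvex with respect to $\eta$ if $g(u+t\,\eta(v,u))\le(1-t)g(u)+t\,g(v)$ for all $u,v\in I$, $t\in[0,1]$. $f'$ is the derivative of $f$; the hypothesis that $|f'|^q$ is preinvex on $I$ presupposes that $f'(x)$ exists at every $x\in I$. *)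

theory Defs
  imports "HOL-Analysis.Analysis"
begin

definition invex_on :: "real set \<Rightarrow> (real \<Rightarrow> real \<Rightarrow> real) \<Rightarrow> bool" where
  "invex_on I \<eta> \<longleftrightarrow>
     (\<forall>u\<in>I. \<forall>v\<in>I. 0 \<le> \<eta> v u \<and> (\<forall>t\<in>{0..1}. u + t * \<eta> v u \<in> I))"

definition preinvex_on :: "real set \<Rightarrow> (real \<Rightarrow> real \<Rightarrow> real) \<Rightarrow> (real \<Rightarrow> real) \<Rightarrow> bool" where
  "preinvex_on I \<eta> g \<longleftrightarrow> invex_on I \<eta> \<and>
     (\<forall>u\<in>I. \<forall>v\<in>I. \<forall>t\<in>{0..1}. g (u + t * \<eta> v u) \<le> (1 - t) * g u + t * g v)"

(* A finite set P of pairs (x, y) stands for the family of intervals [x, y]. The intervals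
   must lie inside I, which matters only if I is not itself an interval; they may share
   endpoints. *)
definition absolutely_continuous_on :: "real set \<Rightarrow> (real \<Rightarrow> real) \<Rightarrow> bool" where
  "absolutely_continuous_on I f \<longleftrightarrow>
     (\<forall>\<epsilon>>0. \<exists>\<delta>>0. \<forall>P. finite P \<and>
        (\<forall>(x, y)\<in>P. x < y \<and> {x..y} \<subseteq> I) \<and>
        disjoint_family_on (\<lambda>(x, y). {x<..<y}) P \<and>
        (\<Sum>(x, y)\<in>P. y - x) < \<delta>
        \<longrightarrow> (\<Sum>(x, y)\<in>P. \<bar>f y - f x\<bar>) < \<epsilon>)"

end

theory Submission
  imports Defs
begin

text \<open>
  Put \<open>h = \<eta> b a > 0\<close> and \<open>F t = f (a + t * h)\<close> on \<open>[0, 1]\<close>. The error of Simpson's rule for \<open>F\<close>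
  is the integral of \<open>k t * F' t\<close>, where \<open>k\<close> is the piecewise linear Peano kernel
  \<open>simpson_kernel\<close>: integrating by parts on each half of \<open>[0, 1]\<close> produces the weights
  1/6, 4/6, 1/6 from the values of \<open>k\<close> at the ends of the halves
  (\<open>has_integral_simpson_error\<close>).

  Preinvexity along the path from \<open>a\<close> to \<open>a + h\<close> bounds \<open>\<bar>F' t\<bar>\<close> by
  \<open>h * G t powr (1 / q)\<close> with the affine function
  \<open>G t = (1 - t) * \<bar>f' a\<bar> powr q + t * \<bar>f' b\<bar> powr q\<close>. Hence Hoelder's inequality
  (\<open>has_integral_Holder_bound\<close>) estimates the error by \<open>h\<close> times the \<open>L\<^sup>p\<close> norm of \<open>k\<close>
  (\<open>has_integral_simpson_kernel_powr\<close>) times the \<open>q\<close>-th root of the integral of \<open>G\<close>, which is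
  the mean of its two end values. These are the two factors of the claimed bound.

  All integrals are gauge integrals, for which every derivative on a compact interval is
  integrable with the expected value; this is why \<open>k t * F' t\<close> can be integrated directly.
  Hoelder's inequality is applied to \<open>\<bar>k\<bar>\<close> and to the majorant of \<open>\<bar>F'\<bar>\<close>, which are explicit.
\<close>

section \<open>Hoelder's inequality for majorants\<close>

text \<open>
  Divide \<open>u\<close> and \<open>v\<close> by the upper bounds \<open>P' powr (1 / p)\<close> and \<open>Q' powr (1 / q)\<close> of their norms
  and integrate Young's inequality \<open>x * y \<le> x powr p / p + y powr q / q\<close>: its rescaled right-hand side
  \<open>w\<close> has an integral computed from \<open>P\<close> and \<open>Q\<close>, and both \<open>\<phi>\<close> and \<open>- \<phi>\<close> lie below \<open>w\<close>.
\<close>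

lemma has_integral_Holder_bound_less:
  fixes \<phi> u v :: "'a::euclidean_space \<Rightarrow> real"
  assumes pq: "p > 1" "q > 1" "1 / p + 1 / q = 1"
    and \<phi>: "(\<phi> has_integral J) S"
    and P: "((\<lambda>t. u t powr p) has_integral P) S"
    and Q: "((\<lambda>t. v t powr q) has_integral Q) S"
    and nonneg: "\<And>t. t \<in> S \<Longrightarrow> 0 \<le> u t" "\<And>t. t \<in> S \<Longrightarrow> 0 \<le> v t"
    and le: "\<And>t. t \<in> S \<Longrightarrow> \<bar>\<phi> t\<bar> \<le> u t * v t"
    and less: "P < P'" "Q < Q'" "0 < P'" "0 < Q'"
  shows "\<bar>J\<bar> \<le> P' powr (1 / p) * Q' powr (1 / q)"
proof -
  define C where "C = P' powr (1 / p) * Q' powr (1 / q)"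
  have C: "C > 0"
    using less by (simp add: C_def)
  define w where "w = (\<lambda>t. C * (u t powr p * (1 / (P' * p)) + v t powr q * (1 / (Q' * q))))"
  have w: "(w has_integral C * (P * (1 / (P' * p)) + Q * (1 / (Q' * q)))) S"
    unfolding w_def
    by (intro has_integral_mult_right has_integral_add has_integral_mult_left P Q)
  have "\<bar>\<phi> t\<bar> \<le> w t" if t: "t \<in> S" for t
  proof -
    have "u t / P' powr (1 / p) * (v t / Q' powr (1 / q))
      \<le> (u t / P' powr (1 / p)) powr p / p + (v t / Q' powr (1 / q)) powr q / q"
      using pq nonneg[OF t] by (intro Youngs_inequality) auto
    also have "\<dots> = u t powr p * (1 / (P' * p)) + v t powr q * (1 / (Q' * q))"
      using pq nonneg[OF t] less by (simp add: powr_divide powr_powr)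
    finally have "u t * v t / C
      \<le> u t powr p * (1 / (P' * p)) + v t powr q * (1 / (Q' * q))"
      by (simp add: C_def)
    then have "u t * v t \<le> w t"
      using C unfolding w_def by (simp only: pos_divide_le_eq mult.commute)
    with le[OF t] show ?thesis
      by simp
  qed
  then have "J \<le> C * (P * (1 / (P' * p)) + Q * (1 / (Q' * q)))"
    and "- J \<le> C * (P * (1 / (P' * p)) + Q * (1 / (Q' * q)))"
    by (meson has_integral_le[OF \<phi> w] has_integral_le[OF has_integral_neg[OF \<phi>] w] abs_le_iff)+
  moreover have "P * (1 / (P' * p)) + Q * (1 / (Q' * q)) \<le> 1 / p + 1 / q"
    using less pq by (intro add_mono) (simp_all add: field_simps)
  then have "C * (P * (1 / (P' * p)) + Q * (1 / (Q' * q))) \<le> C"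
    using C pq(3) by (metis mult.right_neutral mult_left_mono less_imp_le)
  ultimately show ?thesis
    unfolding C_def by linarith
qed

text \<open>
  Letting the strict upper bounds of the previous lemma decrease to \<open>P\<close> and \<open>Q\<close> covers the
  case that one of them vanishes, where the division by the norm would be impossible.
\<close>

lemma has_integral_Holder_bound:
  fixes \<phi> u v :: "'a::euclidean_space \<Rightarrow> real"
  assumes pq: "p > 1" "q > 1" "1 / p + 1 / q = 1"
    and \<phi>: "(\<phi> has_integral J) S"
    and P: "((\<lambda>t. u t powr p) has_integral P) S"
    and Q: "((\<lambda>t. v t powr q) has_integral Q) S"
    and nonneg: "\<And>t. t \<in> S \<Longrightarrow> 0 \<le> u t" "\<And>t. t \<in> S \<Longrightarrow> 0 \<le> v t"
    and le: "\<And>t. t \<in> S \<Longrightarrow> \<bar>\<phi> t\<bar> \<le> u t * v t"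
  shows "\<bar>J\<bar> \<le> P powr (1 / p) * Q powr (1 / q)"
proof -
  have P0: "P \<ge> 0" and Q0: "Q \<ge> 0"
    using has_integral_nonneg[OF P] has_integral_nonneg[OF Q] by auto
  have lim: "((\<lambda>e. (P + e) powr (1 / p) * (Q + e) powr (1 / q))
      \<longlongrightarrow> (P + 0) powr (1 / p) * (Q + 0) powr (1 / q)) (at_right 0)"
    using P0 Q0 pq
    by (intro tendsto_mult tendsto_powr' tendsto_add tendsto_const tendsto_ident_at)
       (auto simp: eventually_at_right_less intro!: eventually_at_rightI[of 0 1])
  have "\<forall>\<^sub>F e in at_right 0. \<bar>J\<bar> \<le> (P + e) powr (1 / p) * (Q + e) powr (1 / q)"
    using P0 Q0
    by (intro eventually_at_rightI[of 0 1]
        has_integral_Holder_bound_less[OF pq \<phi> P Q nonneg le]) auto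
  from tendsto_lowerbound[OF lim this] show ?thesis
    by simp
qed

section \<open>The Peano kernel of Simpson's rule\<close>

text \<open>
  Integration by parts in which the integrability of the left-hand side is a conclusion: it is
  the derivative of \<open>(t - c) * F t\<close> minus the continuous function \<open>F\<close>.
\<close>

lemma has_integral_affine_times_derivative:
  fixes F F' :: "real \<Rightarrow> real"
  assumes "l \<le> u"
    and F: "\<And>t. t \<in> {l..u} \<Longrightarrow> (F has_real_derivative F' t) (at t within {l..u})"
  shows "((\<lambda>t. (t - c) * F' t) has_integral
           (u - c) * F u - (l - c) * F l - integral {l..u} F) {l..u}"
proof -
  have "continuous_on {l..u} F"
    using F by (rule DERIV_continuous_on)
  then have int: "(F has_integral integral {l..u} F) {l..u}"
    by (intro integrable_integral integrable_continuous_interval)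
  have "((\<lambda>t. F t + (t - c) * F' t) has_integral (u - c) * F u - (l - c) * F l) {l..u}"
    using \<open>l \<le> u\<close>
    by (intro fundamental_theorem_of_calculus)
       (auto simp flip: has_real_derivative_iff_has_vector_derivative
          intro!: derivative_eq_intros F)
  from has_integral_diff[OF this int] show ?thesis
    by simp
qed

definition simpson_kernel :: "real \<Rightarrow> real" where
  "simpson_kernel t = (if t \<le> 1 / 2 then t - 1 / 6 else t - 5 / 6)"

text \<open>
  The jump of the kernel at the midpoint affects a single point, so an integral involving it
  can be computed from the two affine pieces.
\<close>

lemma has_integral_simpson_kernel:
  fixes g :: "real \<Rightarrow> real \<Rightarrow> real"
  assumes "((\<lambda>t. g (t - 1 / 6) t) has_integral i) {0..1 / 2}"
    and "((\<lambda>t. g (t - 5 / 6) t) has_integral j) {1 / 2..1}"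
  shows "((\<lambda>t. g (simpson_kernel t) t) has_integral i + j) {0..1}"
proof (rule has_integral_combine)
  show "((\<lambda>t. g (simpson_kernel t) t) has_integral i) {0..1 / 2}"
    using assms(1) by (rule has_integral_eq[rotated]) (simp add: simpson_kernel_def)
  show "((\<lambda>t. g (simpson_kernel t) t) has_integral j) {1 / 2..1}"
    by (rule has_integral_spike_finite[OF _ _ assms(2), of "{1 / 2}"])
       (auto simp: simpson_kernel_def)
qed auto

text \<open>
  The zeros 1/6 and 5/6 of the two pieces of the kernel are chosen so that the boundary terms
  of the two integrations by parts have the weights of Simpson's rule.
\<close>

lemma has_integral_simpson_error:
  fixes F F' :: "real \<Rightarrow> real"
  assumes F: "\<And>t. t \<in> {0..1} \<Longrightarrow> (F has_real_derivative F' t) (at t within {0..1})"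
  shows "((\<lambda>t. simpson_kernel t * F' t) has_integral
           1 / 6 * (F 0 + 4 * F (1 / 2) + F 1) - integral {0..1} F) {0..1}"
proof -
  have "(F has_real_derivative F' t) (at t within {0..1 / 2})" if "t \<in> {0..1 / 2}" for t
    using that by (intro DERIV_subset[OF F]) auto
  then have left: "((\<lambda>t. (t - 1 / 6) * F' t) has_integral
      (1 / 2 - 1 / 6) * F (1 / 2) - (0 - 1 / 6) * F 0 - integral {0..1 / 2} F) {0..1 / 2}"
    by (intro has_integral_affine_times_derivative) auto
  have "(F has_real_derivative F' t) (at t within {1 / 2..1})" if "t \<in> {1 / 2..1}" for t
    using that by (intro DERIV_subset[OF F]) auto
  then have right: "((\<lambda>t. (t - 5 / 6) * F' t) has_integral
      (1 - 5 / 6) * F 1 - (1 / 2 - 5 / 6) * F (1 / 2) - integral {1 / 2..1} F) {1 / 2..1}"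
    by (intro has_integral_affine_times_derivative) auto
  have "continuous_on {0..1} F"
    using F by (rule DERIV_continuous_on)
  then have "integral {0..1} F = integral {0..1 / 2} F + integral {1 / 2..1} F"
    by (intro Henstock_Kurzweil_Integration.integral_combine[symmetric]
        integrable_continuous_interval) auto
  then show ?thesis
    using has_integral_simpson_kernel[of "\<lambda>k t. k * F' t", OF left right]
    by (simp add: algebra_simps)
qed

lemma has_integral_powr_dist:
  fixes c l u p :: real
  assumes "l \<le> c" "c \<le> u" "p > 0"
  shows "((\<lambda>t. \<bar>t - c\<bar> powr p) has_integral
           ((c - l) powr (p + 1) + (u - c) powr (p + 1)) / (p + 1)) {l..u}"
proof -
  have left: "((\<lambda>t. \<bar>t - c\<bar> powr p) has_integral
      - ((c - c) powr (p + 1) / (p + 1)) - (- ((c - l) powr (p + 1) / (p + 1)))) {l..c}"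
    using assms
    by (intro fundamental_theorem_of_calculus_interior
          [where f = "\<lambda>t. - ((c - t) powr (p + 1) / (p + 1))"])
       (auto simp flip: has_real_derivative_iff_has_vector_derivative
          intro!: derivative_eq_intros continuous_on_minus continuous_on_divide
            continuous_on_powr' continuous_on_diff continuous_on_id continuous_on_const)
  have right: "((\<lambda>t. \<bar>t - c\<bar> powr p) has_integral
      (u - c) powr (p + 1) / (p + 1) - (c - c) powr (p + 1) / (p + 1)) {c..u}"
    using assms
    by (intro fundamental_theorem_of_calculus_interior
          [where f = "\<lambda>t. (t - c) powr (p + 1) / (p + 1)"])
       (auto simp flip: has_real_derivative_iff_has_vector_derivative
          intro!: derivative_eq_intros continuous_on_minus continuous_on_divide
            continuous_on_powr' continuous_on_diff continuous_on_id continuous_on_const)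
  show ?thesis
    using has_integral_combine[OF assms(1,2) left right] by (simp add: add_divide_distrib)
qed

text \<open>
  The zeros of the kernel cut \<open>[0, 1]\<close> at distances 1/6 and 1/3 from the ends of the two
  halves; the numerator collects the two contributions over the denominator 6.
\<close>

lemma has_integral_simpson_kernel_powr:
  fixes p :: real
  assumes "p > 0"
  shows "((\<lambda>t. \<bar>simpson_kernel t\<bar> powr p) has_integral
           2 * (1 + 2 powr (p + 1)) / (6 powr (p + 1) * (p + 1))) {0..1}"
proof -
  have third: "(1 / 3) powr (p + 1) = 2 powr (p + 1) / 6 powr (p + 1)"
    using powr_divide[of 2 6 "p + 1"] by simp
  have sixth: "(1 / 6) powr (p + 1) = 1 / 6 powr (p + 1)"
    by (simp add: powr_divide)
  have left: "((\<lambda>t. \<bar>t - 1 / 6\<bar> powr p) has_integral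
      (1 + 2 powr (p + 1)) / (6 powr (p + 1) * (p + 1))) {0..1 / 2}"
    using has_integral_powr_dist[of 0 "1 / 6" "1 / 2" p] assms
    by (simp add: third sixth add_divide_distrib)
  have right: "((\<lambda>t. \<bar>t - 5 / 6\<bar> powr p) has_integral
      (1 + 2 powr (p + 1)) / (6 powr (p + 1) * (p + 1))) {1 / 2..1}"
    using has_integral_powr_dist[of "1 / 2" "5 / 6" 1 p] assms
    by (simp add: third sixth add_divide_distrib) (simp only: add.commute)
  have "(1 + 2 powr (p + 1)) / (6 powr (p + 1) * (p + 1))
      + (1 + 2 powr (p + 1)) / (6 powr (p + 1) * (p + 1))
    = 2 * (1 + 2 powr (p + 1)) / (6 powr (p + 1) * (p + 1))"
    by simp
  with has_integral_simpson_kernel[of "\<lambda>k t. \<bar>k\<bar> powr p", OF left right] show ?thesis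
    by (simp only:)
qed

section \<open>The error bound\<close>

lemma has_integral_affine_interpolation:
  fixes A B :: real
  shows "((\<lambda>t. (1 - t) * A + t * B) has_integral (A + B) / 2) {0..1}"
proof -
  have "((\<lambda>t. (1 - t) * A + t * B) has_integral
      (1 * A + 1\<^sup>2 / 2 * (B - A)) - (0 * A + 0\<^sup>2 / 2 * (B - A))) {0..1}"
    by (intro fundamental_theorem_of_calculus[where f = "\<lambda>t. t * A + t\<^sup>2 / 2 * (B - A)"])
       (auto simp flip: has_real_derivative_iff_has_vector_derivative simp: field_simps
          intro!: derivative_eq_intros)
  then show ?thesis
    by (simp add: field_simps)
qed

theorem theorem3:
  fixes I :: "real set" and \<eta> :: "real \<Rightarrow> real \<Rightarrow> real" and f :: "real \<Rightarrow> real"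
    and a b p q :: real
  assumes "open I" and "invex_on I \<eta>"
    and "absolutely_continuous_on I f"
    and "a \<in> I" and "b \<in> I" and "\<eta> b a \<noteq> 0"
    and "q > 1" and "p = q / (q - 1)"
    and "\<forall>x\<in>I. f differentiable (at x)"
    and "preinvex_on I \<eta> (\<lambda>x. \<bar>deriv f x\<bar> powr q)"
  shows "\<bar>1 / 6 * (f a + 4 * f ((2 * a + \<eta> b a) / 2) + f (a + \<eta> b a))
            - 1 / \<eta> b a * integral {a..a + \<eta> b a} f\<bar>
         \<le> \<eta> b a * (2 * (1 + 2 powr (p + 1)) / (6 powr (p + 1) * (p + 1))) powr (1 / p)
            * ((\<bar>deriv f a\<bar> powr q + \<bar>deriv f b\<bar> powr q) / 2) powr (1 / q)"
proof -
  define h where "h = \<eta> b a"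
  define A where "A = \<bar>deriv f a\<bar> powr q"
  define B where "B = \<bar>deriv f b\<bar> powr q"
  define G where "G = (\<lambda>t. (1 - t) * A + t * B)"
  define F where "F = (\<lambda>t. f (a + t * h))"
  define E where "E = 1 / 6 * (F 0 + 4 * F (1 / 2) + F 1) - integral {0..1} F"
  have h: "h > 0"
    using assms(2,4-6) unfolding h_def invex_on_def by force
  have pq: "p > 1" "q > 1" "1 / p + 1 / q = 1"
    using assms(7) unfolding assms(8) by (simp_all add: diff_divide_distrib)
  have path: "a + t * h \<in> I" if "t \<in> {0..1}" for t
    using assms(2,4,5) that unfolding invex_on_def h_def by blast
  have deriv_f: "(f has_real_derivative deriv f x) (at x)" if "x \<in> I" for x
    using assms(9) that
    by (metis DERIV_deriv_iff_real_differentiable)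
  have deriv_F: "(F has_real_derivative deriv f (a + t * h) * h) (at t within {0..1})"
    if "t \<in> {0..1}" for t
    unfolding F_def
    by (rule DERIV_chain2[where f = f and g = "\<lambda>t. a + t * h" and x = t, OF deriv_f[OF path[OF that]]]) (auto intro!: derivative_eq_intros)
  have G_nonneg: "G t \<ge> 0" if "t \<in> {0..1}" for t
    using that by (simp add: G_def A_def B_def)
  have deriv_le: "\<bar>deriv f (a + t * h)\<bar> \<le> G t powr (1 / q)" if t: "t \<in> {0..1}" for t
  proof -
    have "\<bar>deriv f (a + t * h)\<bar> powr q \<le> G t"
      using assms(4,5,10) t unfolding preinvex_on_def h_def G_def A_def B_def by blast
    then have "(\<bar>deriv f (a + t * h)\<bar> powr q) powr (1 / q) \<le> G t powr (1 / q)"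
      using pq by (intro powr_mono2) auto
    then show ?thesis
      using pq by (simp add: powr_powr)
  qed
  have "((\<lambda>t. simpson_kernel t * (deriv f (a + t * h) * h) * (1 / h)) has_integral E * (1 / h))
      {0..1}"
    unfolding E_def
    by (intro has_integral_mult_left has_integral_simpson_error deriv_F)
  then have error: "((\<lambda>t. simpson_kernel t * deriv f (a + t * h)) has_integral E / h) {0..1}"
    using h by simp
  have "((\<lambda>t. (G t powr (1 / q)) powr q) has_integral (A + B) / 2) {0..1}"
  proof (rule has_integral_eq)
    show "(G has_integral (A + B) / 2) {0..1}"
      unfolding G_def by (rule has_integral_affine_interpolation)
  qed (use pq G_nonneg in \<open>simp add: powr_powr\<close>)
  then have bound: "\<bar>E / h\<bar> \<le> (2 * (1 + 2 powr (p + 1)) / (6 powr (p + 1) * (p + 1))) powr (1 / p)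
      * ((A + B) / 2) powr (1 / q)"
    using pq deriv_le
    by (intro has_integral_Holder_bound[OF pq error has_integral_simpson_kernel_powr])
       (auto simp: abs_mult intro!: mult_left_mono)
  have "continuous_on {a..a + h} f"
  proof (intro continuous_at_imp_continuous_on ballI)
    fix x assume "x \<in> {a..a + h}"
    then have "x \<in> I"
      using path[of "(x - a) / h"] h by (simp add: field_simps)
    then show "isCont f x"
      by (rule DERIV_isCont[OF deriv_f])
  qed
  then have "(f has_integral integral {a..a + h} f) (cbox a (a + h))"
    by (simp add: integrable_integral integrable_continuous_interval)
  from has_integral_affinity'[OF this h, of a]
  have "(F has_integral integral {a..a + h} f / h) {0..1}"
    using h by (simp add: F_def field_simps)
  then have "integral {0..1} F = 1 / h * integral {a..a + h} f"
    by (simp add: integral_unique)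
  moreover have "(2 * a + h) / 2 = a + h / 2"
    by (simp add: field_simps)
  ultimately have "E = 1 / 6 * (f a + 4 * f ((2 * a + h) / 2) + f (a + h))
      - 1 / h * integral {a..a + h} f"
    by (simp only: E_def F_def) simp
  then show ?thesis
    using bound h by (simp add: abs_divide pos_divide_le_eq mult_ac flip: h_def A_def B_def)
qed

end
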